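(* Let $V$ be a finite-dimensional real vector space with basis $\mathcal{B}$, and let $\mathbf{T}:V\to V$ and $\eta:V\to\mathbb{R}$ be linear maps such that $(V,\mathcal{B},\mathbf{T},\eta)$ admits the Doob transform. Let $\bar V$ be a quotient space of $V$, with quotient map $\theta:V\to\bar V$. Suppose that 1. the distinct elements of $\{\theta(x):x\in\mathcal{B}\}$ are linearly independent; and 2. $\mathbf{T}$ and $\eta$ descend to maps on $\bar V$, i.e. there exist linear maps $\bar{\mathbf{T}}:\bar V\to\bar V$ and $\bar\eta:\bar V\to\mathbb{R}$ such that $\theta\circ\mathbf{T}=\bar{\mathbf{T}}\circ\theta$ and $\bar\eta\circ\theta=\eta$. Then the Markov chain defined by $\bar{\mathbf{T}}$ on the basis $\bar{\mathcal{B}}:=\{\theta(x):x\in\mathcal{B}\}$ of $\bar V$, with rescaling function $\bar\eta$ (that is, the Doob transform chain of $(\bar V,\bar{\mathcal{B}},\bar{\mathbf{T}},\bar\eta)$), is a strong lumping, via $\theta:\mathcal{B}\to\bar{\mathcal{B}}$, of the Markov chain on $\mathcal{B}$ defined by $\mathbf{T}$ with rescaling function $\eta$.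
   Context: All Markov chains are discrete-time, time-homogeneous, with finite state space $\Omega$; the transition matrix $K$ is given by $K(x,y)=P\{X_t=y\mid X_{t-1}=x\}$. Doob transform. Let $V$ be a finite-dimensional real vector space with basis $\mathcal{B}$, $\mathbf{T}:V\to V$ linear, and let $K(x,y)$ ($x,y\in\mathcal{B}$) be the coefficient of $y$ in the expansion of $\mathbf{T}(x)$ in the basis $\mathcal{B}$. Let $\eta:V\to\mathbb{R}$ be linear. We say $(V,\mathcal{B},\mathbf{T},\eta)$ admits the Doob transform if $K(x,y)\ge 0$ for all $x,y\in\mathcal{B}$, $\eta(x)>0$ for all $x\in\mathcal{B}$, and $\eta\circ\mathbf{T}=\beta\eta$ for some $\beta>0$ (equivalently $\sum_{y}K(x,y)\eta(y)=\beta\eta(x)$ for all $x\in\mathcal{B}$). In that case the matrix $$\check K(x,y):=\frac1\beta K(x,y)\frac{\eta(y)}{\eta(x)}$$ is a transition matrix on state space $\mathcal{B}$; the corresponding Markov chain is called the Markov chain defined by $\mathbf{T}$ (on the basis $\mathcal{B}$, with rescaling function $\eta$), or the Doob transform chain. Strong lumping. Let $\{X_t\},\{\bar X_t\}$ be Markov chains on $\Omega,\bar\Omega$ with transition matrices $K,\bar K$. Then $\{\bar X_t\}$ is a strong lumping of $\{X_t\}$ via $\theta$ if $\theta:\Omega\to\bar\Omega$ is a surjection such that the process $\{\theta(X_t)\}$ is a Markov chain with transition matrix $\bar K$, irrespective of the starting distribution $X_0$. *)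

theory Defs
  imports "HOL-Probability.Probability"
begin

section \<open>Markov chains and strong lumping\<close>

definition transition_matrix :: "'s set \<Rightarrow> ('s \<Rightarrow> 's \<Rightarrow> real) \<Rightarrow> bool" where
  "transition_matrix S K \<longleftrightarrow>
     finite S \<and> (\<forall>x\<in>S. \<forall>y\<in>S. 0 \<le> K x y) \<and> (\<forall>x\<in>S. (\<Sum>y\<in>S. K x y) = 1)"

text \<open>
  The starting distribution, i.e. the law of \<open>X 0\<close>, is unconstrained. Histories \<open>h\<close> are
  functions on all of \<open>nat\<close>, but only the values \<open>h 0, ..., h t\<close> matter. Entries of \<open>K\<close> outside
  the state space \<open>S\<close> are irrelevant.
\<close>
definition markov_chain ::
  "'m measure \<Rightarrow> 's set \<Rightarrow> ('s \<Rightarrow> 's \<Rightarrow> real) \<Rightarrow> (nat \<Rightarrow> 'm \<Rightarrow> 's) \<Rightarrow> bool" where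
  "markov_chain M S K X \<longleftrightarrow>
     prob_space M \<and> transition_matrix S K \<and>
     (\<forall>t. X t \<in> measurable M (count_space S)) \<and>
     (\<forall>t h. \<forall>y\<in>S.
        \<P>(\<omega> in M. \<forall>i\<le>t. X i \<omega> = h i) > 0 \<longrightarrow>
        \<P>(\<omega> in M. X (Suc t) \<omega> = y \<bar> \<forall>i\<le>t. X i \<omega> = h i) = K (h t) y)"

text \<open>
  A definition cannot quantify over types, so the type of sample points is a parameter; a
  theorem that leaves it as a free type variable covers all probability spaces. Quantifying over
  all chains \<open>X\<close> with transition matrix \<open>K\<close> covers all starting distributions.
\<close>
definition strong_lumping ::
  "'m itself \<Rightarrow> 's set \<Rightarrow> ('s \<Rightarrow> 's \<Rightarrow> real) \<Rightarrow> 'r set \<Rightarrow> ('r \<Rightarrow> 'r \<Rightarrow> real) \<Rightarrow> ('s \<Rightarrow> 'r) \<Rightarrow> bool" where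
  "strong_lumping _ S K S' K' \<theta> \<longleftrightarrow>
     transition_matrix S K \<and> transition_matrix S' K' \<and> \<theta> ` S = S' \<and>
     (\<forall>(M :: 'm measure) X. markov_chain M S K X \<longrightarrow> markov_chain M S' K' (\<lambda>t. \<theta> \<circ> X t))"


section \<open>The Doob transform\<close>

text \<open>Finite-dimensionality of the whole type is expressed by the existence of a finite basis.\<close>
definition finite_basis :: "'v::real_vector set \<Rightarrow> bool" where
  "finite_basis B \<longleftrightarrow> finite B \<and> independent B \<and> span B = UNIV"

definition coeff_matrix :: "'v::real_vector set \<Rightarrow> ('v \<Rightarrow> 'v) \<Rightarrow> 'v \<Rightarrow> 'v \<Rightarrow> real" where
  "coeff_matrix B T x y = representation B (T x) y"

definition admits_doob :: "'v::real_vector set \<Rightarrow> ('v \<Rightarrow> 'v) \<Rightarrow> ('v \<Rightarrow> real) \<Rightarrow> bool" where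
  "admits_doob B T \<eta> \<longleftrightarrow>
     (\<forall>x\<in>B. \<forall>y\<in>B. 0 \<le> coeff_matrix B T x y) \<and>
     (\<forall>x\<in>B. 0 < \<eta> x) \<and>
     (\<exists>\<beta>>0. \<forall>v. \<eta> (T v) = \<beta> * \<eta> v)"

text \<open>
  When the Doob transform is admitted and the basis is nonempty, \<open>\<eta>\<close> is not the zero map, so
  \<open>\<beta>\<close> is unique. For the empty basis its value is irrelevant.
\<close>
definition doob_eigenvalue :: "('v::real_vector \<Rightarrow> 'v) \<Rightarrow> ('v \<Rightarrow> real) \<Rightarrow> real" where
  "doob_eigenvalue T \<eta> = (THE \<beta>. 0 < \<beta> \<and> (\<forall>v. \<eta> (T v) = \<beta> * \<eta> v))"

definition doob_matrix ::
  "'v::real_vector set \<Rightarrow> ('v \<Rightarrow> 'v) \<Rightarrow> ('v \<Rightarrow> real) \<Rightarrow> 'v \<Rightarrow> 'v \<Rightarrow> real" where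
  "doob_matrix B T \<eta> x y = 1 / doob_eigenvalue T \<eta> * coeff_matrix B T x y * (\<eta> y / \<eta> x)"


section \<open>Quotient spaces\<close>

text \<open>
  The coset space \<open>V/U\<close> is not a HOL type when \<open>U\<close> is a parameter. The definition says that the
  codomain, with its vector space structure, is a copy of \<open>V/U\<close> with projection \<open>\<theta>\<close>: points
  correspond to the cosets of \<open>U\<close>, and the operations are induced from \<open>V\<close>.
\<close>
definition quotient_space_map ::
  "'v::real_vector set \<Rightarrow> ('v \<Rightarrow> 'w::real_vector) \<Rightarrow> bool" where
  "quotient_space_map U \<theta> \<longleftrightarrow>
     subspace U \<and> linear \<theta> \<and> surj \<theta> \<and> (\<forall>x y. \<theta> x = \<theta> y \<longleftrightarrow> x - y \<in> U)"

end

theory Submission imports Defs begin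

text \<open>
  A chain lumps via \<open>\<theta>\<close> as soon as the total transition probability from \<open>x\<close> into a fibre of \<open>\<theta>\<close>
  depends only on \<open>\<theta> x\<close> (Dynkin's criterion): split a history of the image chain into the
  finitely many histories above it. For Doob chains, expanding \<open>\<theta> (T x) = T' (\<theta> x)\<close> in the basis
  \<open>\<theta> ` B\<close> shows that the coefficients of \<open>T'\<close> are the fibre sums of those of \<open>T\<close>, and the
  rescaling factors are constant on fibres because \<open>\<eta> = \<eta>' \<circ> \<theta>\<close>.
\<close>

section \<open>Dynkin's criterion\<close>

lemma sets_coordinate_eq:
  assumes "X \<in> measurable M (count_space S)"
  shows "{\<omega> \<in> space M. X \<omega> = c} \<in> sets M"
proof -
  \<comment> \<open>The value \<open>c\<close> may lie outside \<open>S\<close>, so it is cut down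
    to \<open>{c} \<inter> S\<close>; as \<open>X\<close> stays in \<open>S\<close>, the preimage
    does not change.\<close>
  have "{\<omega> \<in> space M. X \<omega> = c} = X -` ({c} \<inter> S) \<inter> space M"
    using measurable_space[OF assms] by auto
  then show ?thesis using measurable_sets[OF assms, of "{c} \<inter> S"] by (simp only:) simp
qed

lemma sets_history:
  fixes X :: "nat \<Rightarrow> 'm \<Rightarrow> 's" and t :: nat
  assumes "\<And>i. X i \<in> measurable M (count_space S)"
  shows "{\<omega> \<in> space M. \<forall>i\<le>t. X i \<omega> = h i} \<in> sets M"
proof -
  have "{\<omega> \<in> space M. \<forall>i\<in>{..t}. X i \<omega> = h i} \<in> sets M"
    by (rule sets.sets_Collect_finite_All) (rule sets_coordinate_eq[OF assms], simp)
  then show ?thesis by (simp only: atMost_iff Ball_def)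
qed

text \<open>The product form needs no positive-probability condition: on a null history both sides
  vanish, because the event on the left lies inside the history. It can therefore be summed over all
  histories, null ones included.\<close>

lemma markov_chain_step:
  assumes "markov_chain M S K X" and "y \<in> S"
  shows "\<P>(\<omega> in M. X (Suc t) \<omega> = y \<and> (\<forall>i\<le>t. X i \<omega> = h i)) =
    K (h t) y * \<P>(\<omega> in M. \<forall>i\<le>t. X i \<omega> = h i)"
proof -
  interpret prob_space M using assms(1) by (simp add: markov_chain_def)
  have X: "\<And>i. X i \<in> measurable M (count_space S)"
    using assms(1) by (simp add: markov_chain_def)
  let ?A = "{\<omega> \<in> space M. X (Suc t) \<omega> = y \<and> (\<forall>i\<le>t. X i \<omega> = h i)}"
  let ?H = "{\<omega> \<in> space M. \<forall>i\<le>t. X i \<omega> = h i}"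
  show ?thesis
  proof (cases "measure M ?H > 0")
    case True
    then have "\<P>(\<omega> in M. X (Suc t) \<omega> = y \<bar> \<forall>i\<le>t. X i \<omega> = h i) = K (h t) y"
      using assms by (simp add: markov_chain_def)
    then show ?thesis using True by (simp add: cond_prob_def field_simps)
  next
    case False
    then have "measure M ?H = 0" by (simp add: zero_less_measure_iff)
    moreover have "measure M ?A \<le> measure M ?H"
      by (rule finite_measure_mono[OF _ sets_history[OF X]]) auto
    ultimately show ?thesis using measure_nonneg[of M ?A] by simp
  qed
qed

lemma markov_chain_lump:
  fixes \<theta> :: "'s \<Rightarrow> 'r"
  assumes mc: "markov_chain M S K X"
    and K': "transition_matrix S' K'"
    and img: "\<theta> ` S = S'"
    and fibre: "\<And>x z. x \<in> S \<Longrightarrow> z \<in> S' \<Longrightarrow> (\<Sum>y\<in>{y \<in> S. \<theta> y = z}. K x y) = K' (\<theta> x) z"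
  shows "markov_chain M S' K' (\<lambda>t. \<theta> \<circ> X t)"
proof -
  interpret prob_space M using mc by (simp add: markov_chain_def)
  have X: "\<And>i. X i \<in> measurable M (count_space S)"
    and fin: "finite S"
    using mc by (simp_all add: markov_chain_def transition_matrix_def)
  have XS: "X i \<omega> \<in> S" if "\<omega> \<in> space M" for i \<omega>
    using measurable_space[OF X that] by simp
  have X': "(\<theta> \<circ> X t) \<in> measurable M (count_space S')" for t
    by (rule measurable_comp[OF X]) (use img in auto)
  have step: "\<P>(\<omega> in M. (\<theta> \<circ> X (Suc t)) \<omega> = z \<bar> \<forall>i\<le>t. (\<theta> \<circ> X i) \<omega> = h i) = K' (h t) z"
    if z: "z \<in> S'" and pos: "\<P>(\<omega> in M. \<forall>i\<le>t. (\<theta> \<circ> X i) \<omega> = h i) > 0" for t h z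
  proof -
    \<comment> \<open>Histories above \<open>h\<close>, cut off after time \<open>t\<close>.
      Extensionality on \<open>{..t}\<close> makes \<open>G\<close> finite and lists each history
      once; functions free beyond \<open>t\<close> would repeat the same event infinitely
      often.\<close>
    define G where "G = {g \<in> {..t} \<rightarrow>\<^sub>E S. \<forall>i\<le>t. \<theta> (g i) = h i}"
    define E where "E g = {\<omega> \<in> space M. \<forall>i\<le>t. X i \<omega> = g i}" for g
    define E' where "E' p = {\<omega> \<in> space M. X (Suc t) \<omega> = snd p \<and> (\<forall>i\<le>t. X i \<omega> = fst p i)}"
      for p :: "(nat \<Rightarrow> 's) \<times> 's"
    define F where "F = {y \<in> S. \<theta> y = z}"
    have finG: "finite G" unfolding G_def
      by (rule finite_subset[of _ "{..t} \<rightarrow>\<^sub>E S"]) (auto intro: finite_PiE fin)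
    have finF: "finite F" using fin by (simp add: F_def)
    \<comment> \<open>The truncated path of \<omega> itself is the witness in both unions
      below.\<close>
    have restr: "(\<lambda>i\<in>{..t}. X i \<omega>) \<in> G"
      if "\<omega> \<in> space M" "\<forall>i\<le>t. \<theta> (X i \<omega>) = h i" for \<omega>
      using that XS by (auto simp: G_def)
    \<comment> \<open>This is what makes the events indexed by \<open>G\<close> disjoint: a sample
      point in two of them forces agreement up to \<open>t\<close>, hence equal indices.\<close>
    have eqG: "g = g'" if "g \<in> G" "g' \<in> G" "\<forall>i\<le>t. g i = g' i" for g g'
      by (rule PiE_ext[of _ "{..t}" "\<lambda>_. S"]) (use that in \<open>auto simp: G_def\<close>)
    have H: "{\<omega> \<in> space M. \<forall>i\<le>t. (\<theta> \<circ> X i) \<omega> = h i} = (\<Union>g\<in>G. E g)"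
    proof (intro equalityI subsetI)
      fix \<omega> assume "\<omega> \<in> {\<omega> \<in> space M. \<forall>i\<le>t. (\<theta> \<circ> X i) \<omega> = h i}"
      then show "\<omega> \<in> (\<Union>g\<in>G. E g)"
        by (intro UN_I[OF restr]) (auto simp: E_def)
    qed (auto simp: G_def E_def)
    have A: "{\<omega> \<in> space M. (\<theta> \<circ> X (Suc t)) \<omega> = z \<and> (\<forall>i\<le>t. (\<theta> \<circ> X i) \<omega> = h i)} =
        (\<Union>p\<in>G \<times> F. E' p)" (is "?A = _")
    proof (intro equalityI subsetI)
      fix \<omega> assume \<omega>: "\<omega> \<in> ?A"
      then have "((\<lambda>i\<in>{..t}. X i \<omega>), X (Suc t) \<omega>) \<in> G \<times> F"
        using restr[of \<omega>] XS by (auto simp: F_def)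
      then show "\<omega> \<in> (\<Union>p\<in>G \<times> F. E' p)"
        by (rule UN_I) (use \<omega> in \<open>auto simp: E'_def\<close>)
    qed (auto simp: G_def F_def E'_def)
    have "measure M (\<Union>p\<in>G \<times> F. E' p) = (\<Sum>p\<in>G \<times> F. measure M (E' p))"
    proof (rule finite_measure_finite_Union)
      show "finite (G \<times> F)" using finG finF by simp
      have "E' p \<in> sets M" for p
      proof -
        have "E' p = {\<omega> \<in> space M. X (Suc t) \<omega> = snd p} \<inter>
            {\<omega> \<in> space M. \<forall>i\<le>t. X i \<omega> = fst p i}"
          by (auto simp: E'_def)
        then show ?thesis using sets_coordinate_eq[OF X] sets_history[OF X] by auto
      qed
      then show "E' ` (G \<times> F) \<subseteq> sets M" by auto
      show "disjoint_family_on E' (G \<times> F)"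
        unfolding disjoint_family_on_def
      proof (intro ballI impI, rule ccontr)
        fix p q assume p: "p \<in> G \<times> F" and q: "q \<in> G \<times> F" and "p \<noteq> q" "E' p \<inter> E' q \<noteq> {}"
        then obtain \<omega> where "\<omega> \<in> E' p" "\<omega> \<in> E' q" by auto
        then have "snd p = snd q" "\<forall>i\<le>t. fst p i = fst q i" by (auto simp: E'_def)
        then have "p = q" using p q eqG[of "fst p" "fst q"] by (auto simp: prod_eq_iff)
        with \<open>p \<noteq> q\<close> show False by simp
      qed
    qed
    also have "\<dots> = (\<Sum>g\<in>G. \<Sum>y\<in>F. measure M (E' (g, y)))"
      by (simp add: sum.cartesian_product)
    also have "\<dots> = (\<Sum>g\<in>G. \<Sum>y\<in>F. K (g t) y * measure M (E g))"
      using markov_chain_step[OF mc] by (intro sum.cong) (auto simp: E'_def E_def F_def)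
    \<comment> \<open>Each \<open>g\<close> in \<open>G\<close> ends in the fibre over
      \<open>h t\<close>, so the fibre sum takes the same value for all of them and leaves the sum
      over \<open>G\<close> as a common factor.\<close>
    also have "\<dots> = (\<Sum>g\<in>G. K' (h t) z * measure M (E g))"
    proof (rule sum.cong)
      fix g assume "g \<in> G"
      then have "g t \<in> S" "\<theta> (g t) = h t" by (auto simp: G_def)
      then show "(\<Sum>y\<in>F. K (g t) y * measure M (E g)) = K' (h t) z * measure M (E g)"
        using fibre[of "g t" z] z by (simp add: F_def flip: sum_distrib_right)
    qed simp
    also have "\<dots> = K' (h t) z * (\<Sum>g\<in>G. measure M (E g))"
      by (simp add: sum_distrib_left)
    also have "(\<Sum>g\<in>G. measure M (E g)) = measure M (\<Union>g\<in>G. E g)"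
    proof (rule finite_measure_finite_Union[symmetric])
      show "E ` G \<subseteq> sets M" unfolding E_def by (intro image_subsetI sets_history[OF X])
      show "disjoint_family_on E G"
        unfolding disjoint_family_on_def
      proof (intro ballI impI, rule ccontr)
        fix p q assume p: "p \<in> G" and q: "q \<in> G" and "p \<noteq> q" "E p \<inter> E q \<noteq> {}"
        then obtain \<omega> where "\<omega> \<in> E p" "\<omega> \<in> E q" by auto
        then have "\<forall>i\<le>t. p i = q i" by (auto simp: E_def)
        then show False using eqG[OF p q] \<open>p \<noteq> q\<close> by simp
      qed
    qed (rule finG)
    \<comment> \<open>The joint probability is \<open>K' (h t) z\<close> times that of the image
      history; \<open>pos\<close> allows dividing by the latter.\<close>
    finally show ?thesis
      using pos unfolding cond_prob_def H A by (simp add: field_simps)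
  qed
  show ?thesis
    unfolding markov_chain_def
    using prob_space_axioms K' X' step by blast
qed

lemma strong_lumpingI:
  assumes "transition_matrix S K" and "transition_matrix S' K'" and "\<theta> ` S = S'"
    and "\<And>x z. x \<in> S \<Longrightarrow> z \<in> S' \<Longrightarrow> (\<Sum>y\<in>{y \<in> S. \<theta> y = z}. K x y) = K' (\<theta> x) z"
  shows "strong_lumping TYPE('m) S K S' K' \<theta>"
  unfolding strong_lumping_def using assms markov_chain_lump[OF _ assms(2-4)] by blast

section \<open>Doob transforms and quotients\<close>

text \<open>A basis vector has positive \<eta>-value, so it can be cancelled in the eigenvalue
  equation. Hence \<beta> is unique and the definite description picks it.\<close>

lemma doob_eigenvalue_pos_eq:
  assumes "admits_doob B T \<eta>" and "B \<noteq> {}"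
  shows "0 < doob_eigenvalue T \<eta>" and "\<eta> (T v) = doob_eigenvalue T \<eta> * \<eta> v"
proof -
  obtain x where x: "\<eta> x > 0" using assms by (auto simp: admits_doob_def)
  obtain \<beta> where \<beta>: "0 < \<beta>" "\<forall>v. \<eta> (T v) = \<beta> * \<eta> v"
    using assms(1) by (auto simp: admits_doob_def)
  have "doob_eigenvalue T \<eta> = \<beta>" unfolding doob_eigenvalue_def
  proof (rule the_equality)
    fix \<gamma> assume "0 < \<gamma> \<and> (\<forall>v. \<eta> (T v) = \<gamma> * \<eta> v)"
    then have "\<gamma> * \<eta> x = \<beta> * \<eta> x" using \<beta> by metis
    then show "\<gamma> = \<beta>" using x by simp
  qed (use \<beta> in auto)
  then show "0 < doob_eigenvalue T \<eta>" "\<eta> (T v) = doob_eigenvalue T \<eta> * \<eta> v"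
    using \<beta> by auto
qed

lemma expand_in_finite_basis:
  assumes "finite_basis B"
  shows "(\<Sum>b\<in>B. representation B v b *\<^sub>R b) = v"
  using assms by (intro real_vector.sum_representation_eq) (auto simp: finite_basis_def)

text \<open>Rows sum to 1 because applying \<eta> to the basis expansion of \<open>T x\<close> gives
  the eigenvalue times \<open>\<eta> x\<close>, exactly the normalising denominator.\<close>

lemma transition_matrix_doob:
  assumes B: "finite_basis B" and \<eta>: "linear \<eta>" and doob: "admits_doob B T \<eta>"
  shows "transition_matrix B (doob_matrix B T \<eta>)"
  unfolding transition_matrix_def
proof (intro conjI ballI)
  show "finite B" using B by (simp add: finite_basis_def)
next
  fix x y assume "x \<in> B" "y \<in> B"
  moreover from this have "0 < doob_eigenvalue T \<eta>" using doob_eigenvalue_pos_eq(1)[OF doob] by auto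
  ultimately show "0 \<le> doob_matrix B T \<eta> x y"
    using doob by (auto simp: doob_matrix_def admits_doob_def less_imp_le)
next
  fix x assume x: "x \<in> B"
  then have ne: "B \<noteq> {}" by auto
  let ?\<beta> = "doob_eigenvalue T \<eta>"
  have "\<eta> x > 0" using doob x by (simp add: admits_doob_def)
  moreover have "?\<beta> > 0" using doob_eigenvalue_pos_eq(1)[OF doob ne] .
  moreover have "(\<Sum>y\<in>B. coeff_matrix B T x y * \<eta> y) = ?\<beta> * \<eta> x"
  proof -
    have "(\<Sum>y\<in>B. coeff_matrix B T x y * \<eta> y) = \<eta> (\<Sum>y\<in>B. representation B (T x) y *\<^sub>R y)"
      using \<eta> by (simp add: coeff_matrix_def linear_sum linear_scale)
    also have "\<dots> = ?\<beta> * \<eta> x"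
      by (simp add: expand_in_finite_basis[OF B] doob_eigenvalue_pos_eq(2)[OF doob ne])
    finally show ?thesis .
  qed
  moreover have "(\<Sum>y\<in>B. doob_matrix B T \<eta> x y) =
      (\<Sum>y\<in>B. coeff_matrix B T x y * \<eta> y) / (?\<beta> * \<eta> x)"
    by (simp add: doob_matrix_def sum_divide_distrib)
  ultimately show "(\<Sum>y\<in>B. doob_matrix B T \<eta> x y) = 1" by simp
qed

lemma finite_basis_image:
  assumes "finite_basis B" and "linear \<theta>" and "surj \<theta>" and "independent (\<theta> ` B)"
  shows "finite_basis (\<theta> ` B)"
  using assms linear_span_image[OF assms(2), of B] by (simp add: finite_basis_def)

lemma coeff_matrix_image:
  assumes B: "finite_basis B" and \<theta>: "linear \<theta>" and ind: "independent (\<theta> ` B)"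
    and comm: "\<theta> \<circ> T = T' \<circ> \<theta>" and z: "z \<in> \<theta> ` B"
  shows "coeff_matrix (\<theta> ` B) T' (\<theta> x) z = (\<Sum>y\<in>{y \<in> B. \<theta> y = z}. coeff_matrix B T x y)"
proof -
  have fin: "finite B" using B by (simp add: finite_basis_def)
  define f where
    "f w = (if w \<in> \<theta> ` B then \<Sum>y\<in>{y \<in> B. \<theta> y = w}. coeff_matrix B T x y else 0)" for w
  have supp: "{w. f w \<noteq> 0} \<subseteq> \<theta> ` B" by (auto simp: f_def split: if_splits)
  have "T' (\<theta> x) = \<theta> (\<Sum>y\<in>B. representation B (T x) y *\<^sub>R y)"
    using comm by (simp add: expand_in_finite_basis[OF B] fun_eq_iff)
  also have "\<dots> = (\<Sum>y\<in>B. coeff_matrix B T x y *\<^sub>R \<theta> y)"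
    using \<theta> by (simp add: coeff_matrix_def linear_sum linear_scale)
  also have "\<dots> = (\<Sum>w\<in>\<theta> ` B. \<Sum>y\<in>{y \<in> B. \<theta> y = w}. coeff_matrix B T x y *\<^sub>R \<theta> y)"
    by (rule sum.image_gen[OF fin])
  also have "\<dots> = (\<Sum>w\<in>\<theta> ` B. f w *\<^sub>R w)"
    by (intro sum.cong) (auto simp: f_def scaleR_sum_left)
  finally have T': "T' (\<theta> x) = (\<Sum>w\<in>\<theta> ` B. f w *\<^sub>R w)" .
  have "representation (\<theta> ` B) (T' (\<theta> x)) = f"
  proof (rule real_vector.representation_eqI[OF ind])
    show "T' (\<theta> x) \<in> span (\<theta> ` B)"
      unfolding T' by (intro span_sum span_scale span_base)
    show "finite {w. f w \<noteq> 0}" using supp fin by (meson finite_imageI finite_subset)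
    show "(\<Sum>w | f w \<noteq> 0. f w *\<^sub>R w) = T' (\<theta> x)"
      unfolding T' using supp fin by (intro sum.mono_neutral_left) auto
    show "w \<in> \<theta> ` B" if "f w \<noteq> 0" for w using supp that by auto
  qed
  then show ?thesis using z by (simp add: coeff_matrix_def[of "\<theta> ` B"] f_def)
qed

text \<open>By surjectivity every \<open>w\<close> is some \<open>\<theta> v\<close>. Since \<beta>
  is arbitrary, both the existence of an eigenvalue and its definite description carry over to the
  quotient.\<close>

lemma eigen_equation_descends:
  assumes "surj \<theta>" and "\<theta> \<circ> T = T' \<circ> \<theta>" and "\<eta>' \<circ> \<theta> = \<eta>"
  shows "(\<forall>w. \<eta>' (T' w) = \<beta> * \<eta>' w) \<longleftrightarrow> (\<forall>v. \<eta> (T v) = \<beta> * \<eta> v)"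
proof -
  have "\<eta> v = \<eta>' (\<theta> v)" "\<eta> (T v) = \<eta>' (T' (\<theta> v))" for v
    using assms(2,3) by (metis comp_apply)+
  then show ?thesis using assms(1) by (metis surjD)
qed

theorem theorem2p7:
  fixes B U :: "'v::real_vector set"
    and T :: "'v \<Rightarrow> 'v" and \<eta> :: "'v \<Rightarrow> real"
    and \<theta> :: "'v \<Rightarrow> 'w::real_vector"
    and T' :: "'w \<Rightarrow> 'w" and \<eta>' :: "'w \<Rightarrow> real"
  assumes "finite_basis B" and "linear T" and "linear \<eta>"
    and "admits_doob B T \<eta>"
    and "quotient_space_map U \<theta>"
    and "independent (\<theta> ` B)"
    and "linear T'" and "linear \<eta>'"
    and "\<theta> \<circ> T = T' \<circ> \<theta>" and "\<eta>' \<circ> \<theta> = \<eta>"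
  shows "finite_basis (\<theta> ` B) \<and> admits_doob (\<theta> ` B) T' \<eta>' \<and>
    strong_lumping TYPE('m) B (doob_matrix B T \<eta>) (\<theta> ` B) (doob_matrix (\<theta> ` B) T' \<eta>') \<theta>"
proof (intro conjI)
  have \<theta>: "linear \<theta>" "surj \<theta>" using assms(5) by (auto simp: quotient_space_map_def)
  have \<eta>: "\<eta>' (\<theta> v) = \<eta> v" for v using assms(10) by auto
  note coeff = coeff_matrix_image[OF assms(1) \<theta>(1) assms(6) assms(9)]
  note eigen = eigen_equation_descends[OF \<theta>(2) assms(9,10)]
  show basis: "finite_basis (\<theta> ` B)"
    using finite_basis_image assms(1,6) \<theta> by blast
  show doob: "admits_doob (\<theta> ` B) T' \<eta>'"
    unfolding admits_doob_def eigen
  proof (intro conjI ballI)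
    fix w z assume "w \<in> \<theta> ` B" and z: "z \<in> \<theta> ` B"
    then obtain x where x: "x \<in> B" "w = \<theta> x" by auto
    then show "0 \<le> coeff_matrix (\<theta> ` B) T' w z"
      using assms(4) by (auto simp: coeff[OF z] admits_doob_def intro!: sum_nonneg)
  qed (use assms(4) \<eta> in \<open>auto simp: admits_doob_def\<close>)
  \<comment> \<open>The two descriptions have equivalent predicates, so they agree even for an empty
    basis, where uniqueness may fail.\<close>
  have ev: "doob_eigenvalue T' \<eta>' = doob_eigenvalue T \<eta>"
    by (simp add: doob_eigenvalue_def eigen)
  show "strong_lumping TYPE('m) B (doob_matrix B T \<eta>) (\<theta> ` B) (doob_matrix (\<theta> ` B) T' \<eta>') \<theta>"
  proof (rule strong_lumpingI)
    show "transition_matrix B (doob_matrix B T \<eta>)"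
      using assms(1,3,4) by (rule transition_matrix_doob)
    show "transition_matrix (\<theta> ` B) (doob_matrix (\<theta> ` B) T' \<eta>')"
      using basis assms(8) doob by (rule transition_matrix_doob)
  next
    fix x z assume z: "z \<in> \<theta> ` B"
    \<comment> \<open>On the fibre over \<open>z\<close>, \<open>\<eta> y\<close> equals
      \<open>\<eta>' z\<close>, so only the coefficients of \<open>T\<close> still depend on
      \<open>y\<close>.\<close>
    have "(\<Sum>y\<in>{y \<in> B. \<theta> y = z}. doob_matrix B T \<eta> x y) =
        (\<Sum>y\<in>{y \<in> B. \<theta> y = z}.
          1 / doob_eigenvalue T \<eta> * coeff_matrix B T x y * (\<eta>' z / \<eta> x))"
      by (intro sum.cong) (auto simp: doob_matrix_def \<eta>)
    also have "\<dots> = doob_matrix (\<theta> ` B) T' \<eta>' (\<theta> x) z"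
      unfolding doob_matrix_def ev coeff[OF z] \<eta>
      by (simp only: sum_distrib_left sum_distrib_right)
    finally show "(\<Sum>y\<in>{y \<in> B. \<theta> y = z}. doob_matrix B T \<eta> x y) =
        doob_matrix (\<theta> ` B) T' \<eta>' (\<theta> x) z" .
  qed simp
qed

end
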